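(* Let all the variables $L_1,U_1,A_1,\ldots,L_n,U_n,A_n,L_{n+1}$ be discrete. Suppose that extended stability holds, i.e. with $\sigma$ taking values in $\{o,s\}$, $$(L_i,U_i)\perp\!\!\!\perp\sigma\mid(\overline{L}_{i-1},\overline{U}_{i-1},\overline{A}_{i-1})\qquad(i=1,\ldots,n+1),$$ and let $s$ be a control strategy, so that $$A_i\perp\!\!\!\perp\overline{U}_i\mid(\overline{L}_i,\overline{A}_{i-1};s)\qquad(i=1,\ldots,n).$$ Suppose further that sequential irrelevance holds in the interventional regime $s$: $$L_i\perp\!\!\!\perp\overline{U}_{i-1}\mid(\overline{L}_{i-1},\overline{A}_{i-1};s)\qquad(i=1,\ldots,n+1).$$ Then simple stability holds: with $\sigma$ taking values in $\{o,s\}$, $$L_i\perp\!\!\!\perp\sigma\mid(\overline{L}_{i-1},\overline{A}_{i-1})\qquad(i=1,\ldots,n+1).$$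
   Context: Setting. $L_1,U_1,A_1,\ldots,L_n,U_n,A_n,L_{n+1}\equiv Y$ are discrete random variables on a common measurable space: observable variables $L_i$, unobserved variables $U_i$, action variables $A_i$, outcome $Y$. Write $\overline{L}_i=(L_1,\ldots,L_i)$, and similarly $\overline{U}_i,\overline{A}_i$; index $0$ denotes the empty sequence, and $U_{n+1}$ is empty. There are two regimes, the observational regime $o$ and an interventional regime $s$, with probability measures $P_o$ and $P_s$. The regime indicator $\sigma$ is a non-stochastic variable labelling the regimes. Conditional independence (discrete case). $X\perp\!\!\!\perp\sigma\mid Z$, with $\sigma$ taking values in $\{o,s\}$, means that there is a function $w(x,z)$ such that for each $r\in\{o,s\}$, $P_r(X=x\mid Z=z)=w(x,z)$ whenever $P_r(Z=z)>0$. The statement $X\perp\!\!\!\perp Y\mid(Z;s)$ is ordinary conditional independence of $X$ and $Y$ given $Z$ under $P_s$. A control strategy is a regime $s$ satisfying the second displayed condition of the claim and for which the conditional distribution of $A_i$ given $(\overline{L}_i,\overline{A}_{i-1})$ under $P_s$ is known (regarded as given). No positivity (absolute continuity) relation between $P_o$ and $P_s$ is assumed. *)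

theory Defs
  imports "HOL-Probability.Probability"
begin

text \<open>
  The values of the regime indicator: the observational regime o and the interventional regime s.
\<close>

datatype regime = Obs | Intv

text \<open>
  The target type may be uncountable; only the range has to be countable. So the members of a
  sequence of discrete variables share a type but may have different value spaces.
\<close>

definition discrete_rv :: "'w measure \<Rightarrow> ('w \<Rightarrow> 'a) \<Rightarrow> bool" where
  "discrete_rv M X \<longleftrightarrow> X \<in> measurable M (count_space UNIV) \<and> countable (X ` space M)"

text \<open>
  The joint variable of the first i members of a sequence whose indices start at 1.
\<close>

definition hist :: "(nat \<Rightarrow> 'w \<Rightarrow> 'a) \<Rightarrow> nat \<Rightarrow> 'w \<Rightarrow> 'a list" where
  "hist X i \<omega> = map (\<lambda>j. X j \<omega>) [1..<Suc i]"

definition regime_indep ::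
  "(regime \<Rightarrow> 'w measure) \<Rightarrow> ('w \<Rightarrow> 'a) \<Rightarrow> ('w \<Rightarrow> 'c) \<Rightarrow> bool" where
  "regime_indep P X Z \<longleftrightarrow>
     (\<exists>w. \<forall>r x z. \<P>(\<omega> in P r. Z \<omega> = z) > 0 \<longrightarrow>
        \<P>(\<omega> in P r. X \<omega> = x \<bar> Z \<omega> = z) = w x z)"

definition disc_cond_indep ::
  "'w measure \<Rightarrow> ('w \<Rightarrow> 'a) \<Rightarrow> ('w \<Rightarrow> 'b) \<Rightarrow> ('w \<Rightarrow> 'c) \<Rightarrow> bool" where
  "disc_cond_indep M X Y Z \<longleftrightarrow>
     (\<forall>x y z. \<P>(\<omega> in M. Z \<omega> = z) > 0 \<longrightarrow>
        \<P>(\<omega> in M. X \<omega> = x \<and> Y \<omega> = y \<bar> Z \<omega> = z) =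
        \<P>(\<omega> in M. X \<omega> = x \<bar> Z \<omega> = z) * \<P>(\<omega> in M. Y \<omega> = y \<bar> Z \<omega> = z))"

text \<open>
  The variable at index n + 1 of U is empty, so at that stage the pair (L, U) is just L.
\<close>

definition extended_stability ::
  "nat \<Rightarrow> (regime \<Rightarrow> 'w measure) \<Rightarrow> (nat \<Rightarrow> 'w \<Rightarrow> 'l) \<Rightarrow> (nat \<Rightarrow> 'w \<Rightarrow> 'u) \<Rightarrow>
   (nat \<Rightarrow> 'w \<Rightarrow> 'a) \<Rightarrow> bool" where
  "extended_stability n P L U A \<longleftrightarrow>
     (\<forall>i\<in>{1..n}. regime_indep P (\<lambda>\<omega>. (L i \<omega>, U i \<omega>))
        (\<lambda>\<omega>. (hist L (i - 1) \<omega>, hist U (i - 1) \<omega>, hist A (i - 1) \<omega>))) \<and>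
     regime_indep P (L (n + 1)) (\<lambda>\<omega>. (hist L n \<omega>, hist U n \<omega>, hist A n \<omega>))"

text \<open>
  The kernel \<open>\<pi> i\<close> is the given conditional distribution of the i-th action: its arguments are the
  observed past of L up to i, the past actions up to i - 1, and the value of the i-th action.
  It is pinned down only where the conditioning event has positive probability.
\<close>

definition control_strategy ::
  "nat \<Rightarrow> 'w measure \<Rightarrow> (nat \<Rightarrow> 'w \<Rightarrow> 'l) \<Rightarrow> (nat \<Rightarrow> 'w \<Rightarrow> 'u) \<Rightarrow>
   (nat \<Rightarrow> 'w \<Rightarrow> 'a) \<Rightarrow> (nat \<Rightarrow> 'l list \<Rightarrow> 'a list \<Rightarrow> 'a \<Rightarrow> real) \<Rightarrow> bool" where
  "control_strategy n M L U A \<pi> \<longleftrightarrow>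
     (\<forall>i\<in>{1..n}. disc_cond_indep M (A i) (hist U i) (\<lambda>\<omega>. (hist L i \<omega>, hist A (i - 1) \<omega>))) \<and>
     (\<forall>i\<in>{1..n}. \<forall>l a b. \<P>(\<omega> in M. (hist L i \<omega>, hist A (i - 1) \<omega>) = (l, a)) > 0 \<longrightarrow>
        \<P>(\<omega> in M. A i \<omega> = b \<bar> (hist L i \<omega>, hist A (i - 1) \<omega>) = (l, a)) = \<pi> i l a b)"

definition sequential_irrelevance ::
  "nat \<Rightarrow> 'w measure \<Rightarrow> (nat \<Rightarrow> 'w \<Rightarrow> 'l) \<Rightarrow> (nat \<Rightarrow> 'w \<Rightarrow> 'u) \<Rightarrow> (nat \<Rightarrow> 'w \<Rightarrow> 'a) \<Rightarrow> bool" where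
  "sequential_irrelevance n M L U A \<longleftrightarrow>
     (\<forall>i\<in>{1..n + 1}. disc_cond_indep M (L i) (hist U (i - 1))
        (\<lambda>\<omega>. (hist L (i - 1) \<omega>, hist A (i - 1) \<omega>)))"

definition simple_stability ::
  "nat \<Rightarrow> (regime \<Rightarrow> 'w measure) \<Rightarrow> (nat \<Rightarrow> 'w \<Rightarrow> 'l) \<Rightarrow> (nat \<Rightarrow> 'w \<Rightarrow> 'a) \<Rightarrow> bool" where
  "simple_stability n P L A \<longleftrightarrow>
     (\<forall>i\<in>{1..n + 1}. regime_indep P (L i) (\<lambda>\<omega>. (hist L (i - 1) \<omega>, hist A (i - 1) \<omega>)))"

end

theory Submission
  imports Defs
begin

text \<open>
  Fix a history \<open>(l, a)\<close> of the observables and the actions that both regimes visit; only there do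
  the two regimes have to agree. In regime \<open>s\<close>, sequential irrelevance says that the law of the next
  \<open>L\<close> is the same for every \<open>u\<close> with \<open>P\<^sub>s(l, u, a) > 0\<close>, namely its law given \<open>(l, a)\<close>. By
  extended stability this is also the law of the next \<open>L\<close> given \<open>(l, u, a)\<close> in regime \<open>o\<close>, as long
  as both regimes visit \<open>(l, u, a)\<close>. Averaging over the values \<open>u\<close> that regime \<open>o\<close> visits gives the
  claim (\<open>regime_indep_drop_irrelevant\<close>), provided that each of these values is visited in
  regime \<open>s\<close> too.

  The proviso is where the argument could fail, as no absolute continuity between the regimes is
  assumed. It holds because of the control strategy (\<open>interventional_support\<close>): walk along a
  history \<open>(l, u, a)\<close> that regime \<open>o\<close> visits. Extended stability makes each step \<open>(L, U)\<close> as likely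
  in regime \<open>s\<close> as in regime \<open>o\<close>, hence possible. Each action is possible in regime \<open>s\<close> given
  \<open>(l, a)\<close>, because \<open>(l, a)\<close> is visited, and then also given \<open>(l, u, a)\<close>, because the strategy
  ignores \<open>u\<close>.

  Conditional probabilities are handled as cross-multiplied identities between joint
  probabilities, so that summing over a hidden variable is one use of countable additivity
  (\<open>scaled_prob_eq_if_fibrewise\<close>).
\<close>

section \<open>Discrete random variables\<close>

lemma discrete_rv_cong_sets:
  assumes "sets M = sets N"
  shows "discrete_rv M X \<longleftrightarrow> discrete_rv N X"
  by (simp add: discrete_rv_def measurable_cong_sets[OF assms refl] sets_eq_imp_space_eq[OF assms])

lemma measurable_discrete_rv: "discrete_rv M X \<Longrightarrow> X \<in> measurable M (count_space UNIV)"
  by (simp add: discrete_rv_def)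

lemma discrete_rv_combine:
  assumes X: "discrete_rv M X" and Y: "discrete_rv M Y"
  shows "discrete_rv M (\<lambda>\<omega>. f (X \<omega>) (Y \<omega>))"
  unfolding discrete_rv_def
proof
  have "X \<in> measurable M (count_space (X ` space M))"
    using X by (auto simp: discrete_rv_def intro!: measurable_count_space_extend[of _ UNIV X])
  then show "(\<lambda>\<omega>. f (X \<omega>) (Y \<omega>)) \<in> measurable M (count_space UNIV)"
    using X Y
    by (intro measurable_compose_countable'[where f="\<lambda>x \<omega>. f x (Y \<omega>)" and g=X])
       (auto simp: discrete_rv_def intro: measurable_compose[of Y])
  have "(\<lambda>\<omega>. f (X \<omega>) (Y \<omega>)) ` space M
      \<subseteq> (\<lambda>(x, y). f x y) ` (X ` space M \<times> Y ` space M)"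
    by auto
  moreover have "countable \<dots>"
    using X Y by (simp add: discrete_rv_def)
  ultimately show "countable ((\<lambda>\<omega>. f (X \<omega>) (Y \<omega>)) ` space M)"
    by (rule countable_subset)
qed

lemma hist_0: "hist X 0 \<omega> = []"
  by (simp add: hist_def)

lemma hist_Suc: "hist X (Suc i) \<omega> = hist X i \<omega> @ [X (Suc i) \<omega>]"
  by (simp add: hist_def)

lemma discrete_rv_hist:
  assumes "\<And>j. j \<in> {1..i} \<Longrightarrow> discrete_rv M (X j)"
  shows "discrete_rv M (hist X i)"
  using assms
proof (induction i)
  case 0
  have "countable ((\<lambda>\<omega>. []) ` space M)"
    by (rule countable_subset[of _ "{[]}"]) auto
  then show ?case
    by (simp add: discrete_rv_def hist_0[abs_def])
next
  case (Suc i)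
  then show ?case
    unfolding hist_Suc[abs_def]
    by (intro discrete_rv_combine[where f="\<lambda>xs x. xs @ [x]"]) auto
qed

section \<open>Probabilities of events\<close>

lemma pos_factor_if_prod_eq:
  fixes p q r s :: real
  assumes "p * q = r * s" "p > 0" "q > 0" "r > 0"
  shows "s > 0"
proof -
  have "r * s > 0"
    unfolding assms(1)[symmetric] using assms(2,3) by (rule mult_pos_pos)
  then show ?thesis
    using assms(4) by (simp add: zero_less_mult_iff)
qed

lemma prob_pos_imp_ex:
  assumes "\<P>(\<omega> in M. Q \<omega>) > 0"
  shows "\<exists>\<omega>\<in>space M. Q \<omega>"
proof (rule ccontr)
  assume "\<not> (\<exists>\<omega>\<in>space M. Q \<omega>)"
  then have "{\<omega> \<in> space M. Q \<omega>} = {}" by auto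
  with assms show False by simp
qed

lemma (in finite_measure) prob_pos_mono:
  assumes "\<P>(\<omega> in M. Q \<omega>) > 0" "{\<omega> \<in> space M. R \<omega>} \<in> sets M"
    and "\<And>\<omega>. \<omega> \<in> space M \<Longrightarrow> Q \<omega> \<Longrightarrow> R \<omega>"
  shows "\<P>(\<omega> in M. R \<omega>) > 0"
  using assms(1) finite_measure_mono[OF _ assms(2), of "{\<omega> \<in> space M. Q \<omega>}"] assms(3)
  by fastforce

text \<open>
  Two measures appear so that this serves both for summing within one regime and for comparing
  marginals across the regimes.
\<close>

lemma scaled_prob_eq_if_fibrewise:
  fixes c d :: real
  assumes "finite_measure M" "finite_measure N"
    and sets: "sets N = sets M" and Y: "discrete_rv M Y"
    and E: "{\<omega> \<in> space M. E \<omega>} \<in> sets M" and F: "{\<omega> \<in> space M. F \<omega>} \<in> sets M"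
    and "c \<ge> 0" "d \<ge> 0"
    and eq: "\<And>y. c * \<P>(\<omega> in M. E \<omega> \<and> Y \<omega> = y) = d * \<P>(\<omega> in N. F \<omega> \<and> Y \<omega> = y)"
  shows "c * \<P>(\<omega> in M. E \<omega>) = d * \<P>(\<omega> in N. F \<omega>)"
proof -
  interpret M: finite_measure M by fact
  interpret N: finite_measure N by fact
  have space: "space N = space M" using sets by (rule sets_eq_imp_space_eq)
  define I where "I = Y ` space M"
  have I: "countable I" using Y by (simp add: I_def discrete_rv_def)
  have [measurable]: "Y \<in> measurable M (count_space UNIV)"
    using Y by (rule measurable_discrete_rv)
  have split: "emeasure K {\<omega> \<in> space M. Q \<omega>}
      = (\<integral>\<^sup>+y. emeasure K {\<omega> \<in> space M. Q \<omega> \<and> Y \<omega> = y} \<partial>count_space I)"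
    if K: "sets K = sets M" and Q[measurable]: "{\<omega> \<in> space M. Q \<omega>} \<in> sets M" for K Q
  proof -
    have "{\<omega> \<in> space M. Q \<omega>} = (\<Union>y\<in>I. {\<omega> \<in> space M. Q \<omega> \<and> Y \<omega> = y})"
      by (auto simp: I_def)
    also have "emeasure K \<dots> = (\<integral>\<^sup>+y. emeasure K {\<omega> \<in> space M. Q \<omega> \<and> Y \<omega> = y} \<partial>count_space I)"
      using I by (intro emeasure_UN_countable) (auto simp: K disjoint_family_on_def)
    finally show ?thesis .
  qed
  have "ennreal (c * \<P>(\<omega> in M. E \<omega>)) = ennreal c * emeasure M {\<omega> \<in> space M. E \<omega>}"
    using \<open>c \<ge> 0\<close> by (simp add: ennreal_mult M.emeasure_eq_measure)
  also have "\<dots> = (\<integral>\<^sup>+y. ennreal c * emeasure M {\<omega> \<in> space M. E \<omega> \<and> Y \<omega> = y} \<partial>count_space I)"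
    by (subst split[OF refl E]) (simp add: nn_integral_cmult)
  also have "\<dots> = (\<integral>\<^sup>+y. ennreal d * emeasure N {\<omega> \<in> space M. F \<omega> \<and> Y \<omega> = y} \<partial>count_space I)"
    using \<open>c \<ge> 0\<close> \<open>d \<ge> 0\<close> eq
    by (simp add: M.emeasure_eq_measure N.emeasure_eq_measure space flip: ennreal_mult)
  also have "\<dots> = ennreal d * emeasure N {\<omega> \<in> space M. F \<omega>}"
    by (subst split[OF sets F]) (simp add: nn_integral_cmult)
  also have "\<dots> = ennreal (d * \<P>(\<omega> in N. F \<omega>))"
    using \<open>d \<ge> 0\<close> by (simp add: ennreal_mult N.emeasure_eq_measure space)
  finally show ?thesis
    using \<open>c \<ge> 0\<close> \<open>d \<ge> 0\<close> by (simp add: ennreal_inj)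
qed

section \<open>Conditional independence in cross-multiplied form\<close>

text \<open>
  A value \<open>z\<close> that at most one regime visits puts no constraint on the common kernel \<open>w\<close>: there \<open>w\<close>
  can be read off from the regime that visits it.
\<close>

lemma regime_indep_iff_cross:
  "regime_indep P X Z \<longleftrightarrow>
     (\<forall>x z. \<P>(\<omega> in P Obs. Z \<omega> = z) > 0 \<longrightarrow> \<P>(\<omega> in P Intv. Z \<omega> = z) > 0 \<longrightarrow>
        \<P>(\<omega> in P Intv. Z \<omega> = z) * \<P>(\<omega> in P Obs. X \<omega> = x \<and> Z \<omega> = z) =
        \<P>(\<omega> in P Obs. Z \<omega> = z) * \<P>(\<omega> in P Intv. X \<omega> = x \<and> Z \<omega> = z))"
  (is "_ \<longleftrightarrow> ?cross")
proof
  assume "regime_indep P X Z"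
  then obtain w where w: "\<And>r x z. \<P>(\<omega> in P r. Z \<omega> = z) > 0 \<Longrightarrow>
      \<P>(\<omega> in P r. X \<omega> = x \<bar> Z \<omega> = z) = w x z"
    unfolding regime_indep_def by blast
  show ?cross
  proof (intro allI impI)
    fix x z
    assume pos: "\<P>(\<omega> in P Obs. Z \<omega> = z) > 0" "\<P>(\<omega> in P Intv. Z \<omega> = z) > 0"
    show "\<P>(\<omega> in P Intv. Z \<omega> = z) * \<P>(\<omega> in P Obs. X \<omega> = x \<and> Z \<omega> = z) =
        \<P>(\<omega> in P Obs. Z \<omega> = z) * \<P>(\<omega> in P Intv. X \<omega> = x \<and> Z \<omega> = z)"
      using w[OF pos(1), of x] w[OF pos(2), of x] pos
      by (simp add: cond_prob_def field_simps)
  qed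
next
  assume cross: ?cross
  define w where "w x z = (if \<P>(\<omega> in P Obs. Z \<omega> = z) > 0
      then \<P>(\<omega> in P Obs. X \<omega> = x \<bar> Z \<omega> = z)
      else \<P>(\<omega> in P Intv. X \<omega> = x \<bar> Z \<omega> = z))" for x z
  have "\<P>(\<omega> in P r. X \<omega> = x \<bar> Z \<omega> = z) = w x z"
    if pos: "\<P>(\<omega> in P r. Z \<omega> = z) > 0" for r x z
  proof (cases r)
    case Obs
    then show ?thesis using pos by (simp add: w_def)
  next
    case Intv
    then show ?thesis
      using pos cross[rule_format, of z x] by (simp add: w_def cond_prob_def field_simps)
  qed
  then show "regime_indep P X Z"
    unfolding regime_indep_def by blast
qed

lemma regime_indepD:
  assumes "regime_indep P X Z"
    and "\<P>(\<omega> in P Obs. Z \<omega> = z) > 0" "\<P>(\<omega> in P Intv. Z \<omega> = z) > 0"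
  shows "\<P>(\<omega> in P Intv. Z \<omega> = z) * \<P>(\<omega> in P Obs. X \<omega> = x \<and> Z \<omega> = z) =
         \<P>(\<omega> in P Obs. Z \<omega> = z) * \<P>(\<omega> in P Intv. X \<omega> = x \<and> Z \<omega> = z)"
  using assms unfolding regime_indep_iff_cross by blast

lemma disc_cond_indepD:
  assumes "disc_cond_indep M X Y Z" "\<P>(\<omega> in M. Z \<omega> = z) > 0"
  shows "\<P>(\<omega> in M. Z \<omega> = z) * \<P>(\<omega> in M. (X \<omega> = x \<and> Y \<omega> = y) \<and> Z \<omega> = z) =
         \<P>(\<omega> in M. X \<omega> = x \<and> Z \<omega> = z) * \<P>(\<omega> in M. Y \<omega> = y \<and> Z \<omega> = z)"
proof -
  have clear: "p * a = b * c" if "a / p = b / p * (c / p)" "p > 0" for a b c p :: real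
    using that by (simp add: field_simps)
  show ?thesis
    using assms(1)[unfolded disc_cond_indep_def cond_prob_def, rule_format, OF assms(2)] assms(2)
    by (rule clear)
qed

lemma regime_indep_marginal:
  assumes P: "\<And>r. prob_space (P r)" "\<And>r. sets (P r) = sets M"
    and X: "X \<in> measurable M (count_space UNIV)" and Y: "discrete_rv M Y"
    and Z: "\<And>z. {\<omega> \<in> space M. Z \<omega> = z} \<in> sets M"
    and indep: "regime_indep P (\<lambda>\<omega>. (X \<omega>, Y \<omega>)) Z"
  shows "regime_indep P X Z"
  unfolding regime_indep_iff_cross
proof (intro allI impI)
  fix x z
  assume pos: "\<P>(\<omega> in P Obs. Z \<omega> = z) > 0" "\<P>(\<omega> in P Intv. Z \<omega> = z) > 0"
  have fin: "finite_measure (P r)" for r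
    using P(1) by (rule prob_space.finite_measure)
  have space: "space (P r) = space M" for r
    using P(2) by (rule sets_eq_imp_space_eq)
  have E: "{\<omega> \<in> space (P Obs). X \<omega> = x \<and> Z \<omega> = z} \<in> sets (P Obs)"
    unfolding P(2) space using X Z by measurable
  show "\<P>(\<omega> in P Intv. Z \<omega> = z) * \<P>(\<omega> in P Obs. X \<omega> = x \<and> Z \<omega> = z) =
      \<P>(\<omega> in P Obs. Z \<omega> = z) * \<P>(\<omega> in P Intv. X \<omega> = x \<and> Z \<omega> = z)"
  proof (rule scaled_prob_eq_if_fibrewise[where Y=Y, OF fin fin _ _ E E])
    show "discrete_rv (P Obs) Y"
      using Y discrete_rv_cong_sets[OF P(2)] by blast
    have swap: "(X \<omega> = x \<and> Z \<omega> = z) \<and> Y \<omega> = y \<longleftrightarrow> (X \<omega>, Y \<omega>) = (x, y) \<and> Z \<omega> = z" for \<omega> y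
      by auto
    show "\<P>(\<omega> in P Intv. Z \<omega> = z) * \<P>(\<omega> in P Obs. (X \<omega> = x \<and> Z \<omega> = z) \<and> Y \<omega> = y) =
        \<P>(\<omega> in P Obs. Z \<omega> = z) * \<P>(\<omega> in P Intv. (X \<omega> = x \<and> Z \<omega> = z) \<and> Y \<omega> = y)" for y
      unfolding swap by (rule regime_indepD[OF indep pos])
  qed (simp_all add: P(2))
qed

section \<open>Dropping a hidden variable from the conditioning\<close>

text \<open>
  The support condition is essential: for a value \<open>v\<close> that only regime \<open>o\<close> visits, the law of \<open>X\<close>
  given \<open>(z, v, w)\<close> in regime \<open>o\<close> would be unconstrained.
\<close>

lemma regime_indep_drop_irrelevant:
  assumes P: "\<And>r. prob_space (P r)" "\<And>r. sets (P r) = sets M"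
    and X: "X \<in> measurable M (count_space UNIV)" and Z: "Z \<in> measurable M (count_space UNIV)"
    and V: "discrete_rv M V" and W: "W \<in> measurable M (count_space UNIV)"
    and indep: "regime_indep P X (\<lambda>\<omega>. (Z \<omega>, V \<omega>, W \<omega>))"
    and irrel: "disc_cond_indep (P Intv) X V (\<lambda>\<omega>. (Z \<omega>, W \<omega>))"
    and support: "\<And>z v w. \<P>(\<omega> in P Intv. (Z \<omega>, W \<omega>) = (z, w)) > 0 \<Longrightarrow>
        \<P>(\<omega> in P Obs. (Z \<omega>, V \<omega>, W \<omega>) = (z, v, w)) > 0 \<Longrightarrow>
        \<P>(\<omega> in P Intv. (Z \<omega>, V \<omega>, W \<omega>) = (z, v, w)) > 0"
  shows "regime_indep P X (\<lambda>\<omega>. (Z \<omega>, W \<omega>))"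
  unfolding regime_indep_iff_cross
proof (intro allI impI)
  fix x zw
  assume pos_s: "\<P>(\<omega> in P Intv. (Z \<omega>, W \<omega>) = zw) > 0"
  obtain z w where zw: "zw = (z, w)" by (cases zw)
  interpret Obs: prob_space "P Obs" by (rule P)
  have space: "space (P r) = space M" for r
    using P(2) by (rule sets_eq_imp_space_eq)
  note [measurable] = X Z W measurable_discrete_rv[OF V]
  have E: "{\<omega> \<in> space (P Obs). X \<omega> = x \<and> (Z \<omega>, W \<omega>) = zw} \<in> sets (P Obs)"
    and F: "{\<omega> \<in> space (P Obs). (Z \<omega>, W \<omega>) = zw} \<in> sets (P Obs)"
    unfolding P(2) space zw prod.inject by measurable
  have "\<P>(\<omega> in P Intv. (Z \<omega>, W \<omega>) = zw) * \<P>(\<omega> in P Obs. X \<omega> = x \<and> (Z \<omega>, W \<omega>) = zw) =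
      \<P>(\<omega> in P Intv. X \<omega> = x \<and> (Z \<omega>, W \<omega>) = zw) * \<P>(\<omega> in P Obs. (Z \<omega>, W \<omega>) = zw)"
  proof (rule scaled_prob_eq_if_fibrewise[where Y=V, OF _ _ refl _ E F])
    show "discrete_rv (P Obs) V"
      using V discrete_rv_cong_sets[OF P(2)] by blast
    fix v
    let ?o = "\<P>(\<omega> in P Obs. Z \<omega> = z \<and> V \<omega> = v \<and> W \<omega> = w)"
    let ?s = "\<P>(\<omega> in P Intv. Z \<omega> = z \<and> V \<omega> = v \<and> W \<omega> = w)"
    let ?ox = "\<P>(\<omega> in P Obs. X \<omega> = x \<and> Z \<omega> = z \<and> V \<omega> = v \<and> W \<omega> = w)"
    let ?sx = "\<P>(\<omega> in P Intv. X \<omega> = x \<and> Z \<omega> = z \<and> V \<omega> = v \<and> W \<omega> = w)"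
    let ?t = "\<P>(\<omega> in P Intv. Z \<omega> = z \<and> W \<omega> = w)"
    let ?tx = "\<P>(\<omega> in P Intv. X \<omega> = x \<and> Z \<omega> = z \<and> W \<omega> = w)"
    \<comment> \<open>Where regime \<open>o\<close> visits \<open>(z, v, w)\<close>, \<open>X\<close> has there the law it has given \<open>(z, w)\<close> in regime \<open>s\<close>.\<close>
    have "?t * ?ox = ?tx * ?o"
    proof (cases "?o > 0")
      case True
      then have s: "?s > 0"
        using support[of z w v] pos_s by (simp add: zw)
      have "?s * ?ox = ?o * ?sx"
        using regime_indepD[OF indep, of "(z, v, w)" x] True s by simp
      moreover have "?t * ?sx = ?tx * ?s"
        using disc_cond_indepD[OF irrel pos_s, of x v] by (simp add: zw conj_ac)
      ultimately have "?s * (?t * ?ox) = ?s * (?tx * ?o)"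
        by algebra
      with s show ?thesis by simp
    next
      case False
      moreover have "?ox \<le> ?o"
        by (rule Obs.finite_measure_mono) (auto simp: P(2) space)
      ultimately have "?o = 0" "?ox = 0"
        using measure_nonneg[of "P Obs"] by (meson antisym_conv not_less order_trans)+
      then show ?thesis by (simp only: mult_zero_right)
    qed
    then show "\<P>(\<omega> in P Intv. (Z \<omega>, W \<omega>) = zw) *
          \<P>(\<omega> in P Obs. (X \<omega> = x \<and> (Z \<omega>, W \<omega>) = zw) \<and> V \<omega> = v) =
        \<P>(\<omega> in P Intv. X \<omega> = x \<and> (Z \<omega>, W \<omega>) = zw) *
          \<P>(\<omega> in P Obs. (Z \<omega>, W \<omega>) = zw \<and> V \<omega> = v)"
      by (simp add: zw conj_ac)
  qed (simp_all add: Obs.finite_measure_axioms)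
  then show "\<P>(\<omega> in P Intv. (Z \<omega>, W \<omega>) = zw) * \<P>(\<omega> in P Obs. X \<omega> = x \<and> (Z \<omega>, W \<omega>) = zw) =
      \<P>(\<omega> in P Obs. (Z \<omega>, W \<omega>) = zw) * \<P>(\<omega> in P Intv. X \<omega> = x \<and> (Z \<omega>, W \<omega>) = zw)"
    by (simp add: mult.commute)
qed

section \<open>The support of the interventional regime\<close>

text \<open>
  One step of the walk along a history that regime \<open>o\<close> visits: extended stability carries the
  possibility of \<open>(L, U)\<close> over from regime \<open>o\<close>, and the strategy, being independent of the hidden
  past, then allows every action that it allows given \<open>(l, a)\<close>.
\<close>

lemma interventional_support:
  assumes P: "\<And>r. prob_space (P r)" "\<And>r. sets (P r) = sets M"
    and L: "\<And>i. i \<in> {1..n} \<Longrightarrow> discrete_rv M (L i)"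
    and U: "\<And>i. i \<in> {1..n} \<Longrightarrow> discrete_rv M (U i)"
    and A: "\<And>i. i \<in> {1..n} \<Longrightarrow> discrete_rv M (A i)"
    and ext: "\<And>i. i \<in> {1..n} \<Longrightarrow> regime_indep P (\<lambda>\<omega>. (L i \<omega>, U i \<omega>))
        (\<lambda>\<omega>. (hist L (i - 1) \<omega>, hist U (i - 1) \<omega>, hist A (i - 1) \<omega>))"
    and strategy: "\<And>i. i \<in> {1..n} \<Longrightarrow>
        disc_cond_indep (P Intv) (A i) (hist U i) (\<lambda>\<omega>. (hist L i \<omega>, hist A (i - 1) \<omega>))"
    and "k \<le> n"
    and "\<P>(\<omega> in P Intv. (hist L k \<omega>, hist A k \<omega>) = (l, a)) > 0"
    and "\<P>(\<omega> in P Obs. (hist L k \<omega>, hist U k \<omega>, hist A k \<omega>) = (l, u, a)) > 0"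
  shows "\<P>(\<omega> in P Intv. (hist L k \<omega>, hist U k \<omega>, hist A k \<omega>) = (l, u, a)) > 0"
  using assms(8-)
proof (induction k arbitrary: l u a)
  case 0
  interpret Intv: prob_space "P Intv" by (rule P)
  have "l = [] \<and> u = [] \<and> a = []"
    using prob_pos_imp_ex[OF "0.prems"(3)] by (auto simp: hist_0)
  then show ?case
    by (simp add: hist_0 Intv.prob_space)
next
  case (Suc k)
  interpret Intv: prob_space "P Intv" by (rule P)
  interpret Obs: prob_space "P Obs" by (rule P)
  have space: "space (P r) = space M" for r
    using P(2) by (rule sets_eq_imp_space_eq)
  have k: "Suc k \<in> {1..n}" using Suc.prems by simp
  have [measurable]:
    "hist L k \<in> measurable M (count_space UNIV)" "hist U k \<in> measurable M (count_space UNIV)"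
    "hist A k \<in> measurable M (count_space UNIV)" "L (Suc k) \<in> measurable M (count_space UNIV)"
    "U (Suc k) \<in> measurable M (count_space UNIV)" "A (Suc k) \<in> measurable M (count_space UNIV)"
    using k by (auto intro!: measurable_discrete_rv discrete_rv_hist L U A)
  obtain \<omega>0 where
    "(hist L (Suc k) \<omega>0, hist U (Suc k) \<omega>0, hist A (Suc k) \<omega>0) = (l, u, a)"
    using prob_pos_imp_ex[OF Suc.prems(3)] by blast
  then obtain l' x u' y a' b where lua: "l = l' @ [x]" "u = u' @ [y]" "a = a' @ [b]"
    by (auto simp: hist_Suc)
  have s_la: "\<P>(\<omega> in P Intv. hist L k \<omega> = l' \<and> L (Suc k) \<omega> = x \<and>
      hist A k \<omega> = a' \<and> A (Suc k) \<omega> = b) > 0"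
    using Suc.prems(2) by (simp add: lua hist_Suc conj_ac)
  have o_lua: "\<P>(\<omega> in P Obs. hist L k \<omega> = l' \<and> L (Suc k) \<omega> = x \<and>
      hist U k \<omega> = u' \<and> U (Suc k) \<omega> = y \<and> hist A k \<omega> = a' \<and> A (Suc k) \<omega> = b) > 0"
    using Suc.prems(3) by (simp add: lua hist_Suc conj_ac)
  let ?past = "\<lambda>r. \<P>(\<omega> in P r. (hist L k \<omega>, hist U k \<omega>, hist A k \<omega>) = (l', u', a'))"
  let ?step = "\<lambda>r. \<P>(\<omega> in P r. (L (Suc k) \<omega>, U (Suc k) \<omega>) = (x, y) \<and>
      (hist L k \<omega>, hist U k \<omega>, hist A k \<omega>) = (l', u', a'))"
  have past_o: "?past Obs > 0"
    by (rule Obs.prob_pos_mono[OF o_lua]) (auto simp: P(2) space)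
  have past_s: "?past Intv > 0"
  proof (rule Suc.IH)
    show "\<P>(\<omega> in P Intv. (hist L k \<omega>, hist A k \<omega>) = (l', a')) > 0"
      by (rule Intv.prob_pos_mono[OF s_la]) (auto simp: P(2) space)
  qed (use past_o Suc.prems in auto)
  have step_o: "?step Obs > 0"
    by (rule Obs.prob_pos_mono[OF o_lua]) (auto simp: P(2) space)
  have stable: "?past Intv * ?step Obs = ?past Obs * ?step Intv"
    using regime_indepD[OF ext[OF k], of "(l', u', a')" "(x, y)"] past_o past_s
    by (simp only: diff_Suc_1)
  have step_s: "?step Intv > 0"
    by (rule pos_factor_if_prod_eq[OF stable past_s step_o past_o])
  \<comment> \<open>The strategy conditions on the current \<open>L\<close> but only on earlier actions: \<open>l\<close> is full, \<open>a'\<close> is not.\<close>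
  let ?z = "\<lambda>\<omega>. (hist L (Suc k) \<omega>, hist A (Suc k - 1) \<omega>) = (l, a')"
  have z: "\<P>(\<omega> in P Intv. ?z \<omega>) > 0"
    by (rule Intv.prob_pos_mono[OF s_la]) (auto simp: P(2) space lua hist_Suc)
  have "\<P>(\<omega> in P Intv. A (Suc k) \<omega> = b \<and> ?z \<omega>) > 0"
    by (rule Intv.prob_pos_mono[OF s_la]) (auto simp: P(2) space lua hist_Suc)
  moreover have "\<P>(\<omega> in P Intv. hist U (Suc k) \<omega> = u \<and> ?z \<omega>) > 0"
    by (rule Intv.prob_pos_mono[OF step_s]) (auto simp: P(2) space lua hist_Suc)
  ultimately have
    "\<P>(\<omega> in P Intv. (A (Suc k) \<omega> = b \<and> hist U (Suc k) \<omega> = u) \<and> ?z \<omega>) > 0"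
    by (rule pos_factor_if_prod_eq[OF disc_cond_indepD[OF strategy[OF k] z, symmetric] _ _ z])
  then show ?case
    by (simp add: lua hist_Suc conj_ac)
qed

section \<open>Simple stability\<close>

theorem theorem6p1:
  fixes n :: nat
    and M :: "'w measure"
    and P :: "regime \<Rightarrow> 'w measure"
    and L :: "nat \<Rightarrow> 'w \<Rightarrow> 'l"
    and U :: "nat \<Rightarrow> 'w \<Rightarrow> 'u"
    and A :: "nat \<Rightarrow> 'w \<Rightarrow> 'a"
    and \<pi> :: "nat \<Rightarrow> 'l list \<Rightarrow> 'a list \<Rightarrow> 'a \<Rightarrow> real"
  assumes "\<And>r. prob_space (P r)"
    and "\<And>r. sets (P r) = sets M"
    and "\<And>i. i \<in> {1..n + 1} \<Longrightarrow> discrete_rv M (L i)"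
    and "\<And>i. i \<in> {1..n} \<Longrightarrow> discrete_rv M (U i)"
    and "\<And>i. i \<in> {1..n} \<Longrightarrow> discrete_rv M (A i)"
    and "extended_stability n P L U A"
    and "control_strategy n (P Intv) L U A \<pi>"
    and "sequential_irrelevance n (P Intv) L U A"
  shows "simple_stability n P L A"
  unfolding simple_stability_def
proof
  fix i assume i: "i \<in> {1..n + 1}"
  define k where "k = i - 1"
  have k: "k \<le> n"
    using i by (auto simp: k_def)
  have hist: "discrete_rv M (hist L k)" "discrete_rv M (hist U k)" "discrete_rv M (hist A k)"
    using k by (auto intro!: discrete_rv_hist assms(3-5))
  note [measurable] = hist[THEN measurable_discrete_rv]
  have X: "L i \<in> measurable M (count_space UNIV)"
    using i assms(3) by (intro measurable_discrete_rv)
  have ext: "regime_indep P (\<lambda>\<omega>. (L i \<omega>, U i \<omega>))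
      (\<lambda>\<omega>. (hist L (i - 1) \<omega>, hist U (i - 1) \<omega>, hist A (i - 1) \<omega>))" if "i \<in> {1..n}" for i
    using assms(6) that by (simp add: extended_stability_def)
  have "regime_indep P (L i) (\<lambda>\<omega>. (hist L k \<omega>, hist U k \<omega>, hist A k \<omega>))"
  proof (cases "i = n + 1")
    case True
    then show ?thesis
      using assms(6) by (simp add: extended_stability_def k_def)
  next
    case False
    then have "i \<in> {1..n}" using i by auto
    show ?thesis
    proof (rule regime_indep_marginal[OF assms(1,2) X])
      show "discrete_rv M (U i)" by (rule assms(4)) fact
      show "{\<omega> \<in> space M. (hist L k \<omega>, hist U k \<omega>, hist A k \<omega>) = z} \<in> sets M" for z
        by (cases z) simp
      show "regime_indep P (\<lambda>\<omega>. (L i \<omega>, U i \<omega>)) (\<lambda>\<omega>. (hist L k \<omega>, hist U k \<omega>, hist A k \<omega>))"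
        using ext[OF \<open>i \<in> {1..n}\<close>] by (simp add: k_def)
    qed
  qed
  moreover have "disc_cond_indep (P Intv) (L i) (hist U k) (\<lambda>\<omega>. (hist L k \<omega>, hist A k \<omega>))"
    using assms(8) i by (simp add: sequential_irrelevance_def k_def)
  ultimately have "regime_indep P (L i) (\<lambda>\<omega>. (hist L k \<omega>, hist A k \<omega>))"
  proof (rule regime_indep_drop_irrelevant[OF assms(1,2) X _ hist(2), rotated 2])
    show "\<P>(\<omega> in P Intv. (hist L k \<omega>, hist U k \<omega>, hist A k \<omega>) = (l, u, a)) > 0"
      if "\<P>(\<omega> in P Intv. (hist L k \<omega>, hist A k \<omega>) = (l, a)) > 0"
        "\<P>(\<omega> in P Obs. (hist L k \<omega>, hist U k \<omega>, hist A k \<omega>) = (l, u, a)) > 0" for l u a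
      by (rule interventional_support[where P=P and M=M and n=n, OF assms(1,2) _ assms(4,5) ext _ k])
         (use assms(3,7) that in \<open>auto simp: control_strategy_def\<close>)
  qed measurable
  then show "regime_indep P (L i) (\<lambda>\<omega>. (hist L (i - 1) \<omega>, hist A (i - 1) \<omega>))"
    by (simp add: k_def)
qed

end
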